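(* Let $n\ge1$ and $r\ge1$ be integers, let $\mathbf{m}\in\mathbb{Z}_{>0}^n$ be one of the vectors $(1,\dots,1)$, $(2,\dots,2)$, $(2,\dots,2,1)$, and let $\mathbf{r}=(r,\dots,r)\in\mathbb{Z}^n$. Then the colored multiset Eulerian polynomial $A_{\mathbf{m}}^{\mathbf{r}}$ is $s$-Eulerian, i.e. there exist a sequence of positive integers $s=(s_1,s_2,\dots)$ and an integer $N\ge1$ such that $A_{\mathbf{m}}^{\mathbf{r}}=E_N^s$.
   Context: Let $m=m_1+\cdots+m_n$. A colored multiset permutation in $\mathfrak{S}_{\mathbf{m}}^{\mathbf{r}}$ (for $\mathbf{m}=(m_1,\dots,m_n)$, $\mathbf{r}=(r_1,\dots,r_n)$ positive integer vectors) is a word $\pi^{\mathbf{c}}=\pi_1^{c_1}\cdots\pi_m^{c_m}$ in which each $k\in\{1,\dots,n\}$ appears exactly $m_k$ times among $\pi_1,\dots,\pi_m$, and $1\le c_j\le r_{\pi_j}$ for all $j$. One always appends $\pi_{m+1}^{c_{m+1}}:=(n+1)^1$. Colored letters are totally ordered by $k^{c}<l^{c'}$ iff $c<c'$, or $c=c'$ and $k<l$. A descent is an index $j\in\{1,\dots,m\}$ with $\pi_j^{c_j}>\pi_{j+1}^{c_{j+1}}$, and $\mathrm{des}(\pi^{\mathbf{c}})$ is the number of descents. $A_{\mathbf{m}}^{\mathbf{r}}=\sum_{\pi^{\mathbf{c}}\in\mathfrak{S}_{\mathbf{m}}^{\mathbf{r}}}x^{\mathrm{des}(\pi^{\mathbf{c}})}$.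 For a sequence of positive integers $s=(s_1,s_2,\dots)$ and $N\ge1$, the $s$-lecture hall simplex is $P_N^s=\{x\in\mathbb{R}^N:0\le x_1/s_1\le\cdots\le x_N/s_N\le1\}$, a lattice polytope, and the $s$-Eulerian polynomial is $E_N^s=h^*(P_N^s;x)$. Here, for a $d$-dimensional lattice polytope $P$, $h^*(P;x)$ is the polynomial defined by $1+\sum_{t>0}|tP\cap\mathbb{Z}^N|x^t=h^*(P;x)/(1-x)^{d+1}$. Equivalently, $E_N^s=\sum_{e}x^{\mathrm{asc}(e)}$ over all $e\in\mathbb{Z}^N$ with $0\le e_i\le s_i-1$, where $\mathrm{asc}(e)=|\{i\in\{0,\dots,N-1\}:e_i/s_i<e_{i+1}/s_{i+1}\}|$ with $e_0:=0$, $s_0:=1$. *)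

theory Defs
  imports
    "HOL-Analysis.Analysis"
    "HOL-Library.Function_Algebras"
    "HOL-Computational_Algebra.Polynomial_FPS"
begin

section \<open>Colored multiset Eulerian polynomials\<close>

text \<open>
  A colored letter \<open>k\<^sup>c\<close> is the pair \<open>(k, c)\<close>. The vectors \<open>\<^bold>m = (m 1, \<dots>, m n)\<close> and
  \<open>\<^bold>r = (r 1, \<dots>, r n)\<close> are functions of which only the values on \<open>{1..n}\<close> matter.
\<close>

definition colored_less :: "nat \<times> nat \<Rightarrow> nat \<times> nat \<Rightarrow> bool" where
  "colored_less a b \<longleftrightarrow> snd a < snd b \<or> (snd a = snd b \<and> fst a < fst b)"

text \<open>The length condition is what excludes letters outside \<open>{1..n}\<close>.\<close>

definition colored_mset_perms ::
    "nat \<Rightarrow> (nat \<Rightarrow> nat) \<Rightarrow> (nat \<Rightarrow> nat) \<Rightarrow> (nat \<times> nat) list set" where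
  "colored_mset_perms n m r =
    {w. length w = (\<Sum>k=1..n. m k) \<and>
        (\<forall>k\<in>{1..n}. count_list (map fst w) k = m k) \<and>
        (\<forall>(k, c)\<in>set w. 1 \<le> c \<and> c \<le> r k)}"

text \<open>List positions start at 0, so position \<open>j\<close> holds the letter with index \<open>j + 1\<close>.\<close>

definition des :: "nat \<Rightarrow> (nat \<times> nat) list \<Rightarrow> nat" where
  "des n w = card {j. j < length w \<and>
     colored_less ((w @ [(n + 1, 1)]) ! (j + 1)) ((w @ [(n + 1, 1)]) ! j)}"

definition colored_mset_eulerian :: "nat \<Rightarrow> (nat \<Rightarrow> nat) \<Rightarrow> (nat \<Rightarrow> nat) \<Rightarrow> int poly" where
  "colored_mset_eulerian n m r = (\<Sum>w\<in>colored_mset_perms n m r. monom 1 (des n w))"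

section \<open>The \<open>h\<^sup>*\<close>-polynomial\<close>

text \<open>
  Since the dimension \<open>N\<close> of the ambient space is quantified inside the main statement, \<open>\<real>\<^sup>N\<close> is
  realised as the set of functions \<open>nat \<Rightarrow> real\<close> vanishing outside \<open>{1..N}\<close>. The pointwise
  vector space structure makes the library's \<^const>\<open>dim\<close> available for such functions.
\<close>

instantiation "fun" :: (type, real_vector) real_vector
begin

definition scaleR_fun :: "real \<Rightarrow> ('a \<Rightarrow> 'b) \<Rightarrow> 'a \<Rightarrow> 'b" where
  "scaleR_fun a f = (\<lambda>i. a *\<^sub>R f i)"

instance
  by standard (simp_all add: scaleR_fun_def fun_eq_iff scaleR_add_right scaleR_add_left)

end

definition lattice_points :: "(nat \<Rightarrow> real) set \<Rightarrow> (nat \<Rightarrow> real) set" where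
  "lattice_points S = {x \<in> S. \<forall>i. x i \<in> \<int>}"

text \<open>The dimension of a nonempty set is that of the direction space of its affine hull.\<close>

definition affine_dimension :: "(nat \<Rightarrow> real) set \<Rightarrow> nat" where
  "affine_dimension P = dim {x - y | x y. x \<in> P \<and> y \<in> P}"

definition ehrhart_count :: "(nat \<Rightarrow> real) set \<Rightarrow> nat \<Rightarrow> nat" where
  "ehrhart_count P t = card (lattice_points ((\<lambda>x. real t *\<^sub>R x) ` P))"

text \<open>
  The defining identity \<open>1 + (\<Sum>t>0. |tP \<inter> \<int>\<^sup>N| x\<^sup>t) = h\<^sup>*(P; x) / (1 - x)\<^sup>d\<^sup>+\<^sup>1\<close> of formal power
  series, with the denominator cleared.
\<close>

definition h_star :: "(nat \<Rightarrow> real) set \<Rightarrow> int poly" where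
  "h_star P = (THE h.
     (1 + Abs_fps (\<lambda>t. if t > 0 then int (ehrhart_count P t) else 0)) *
       (1 - fps_X) ^ (affine_dimension P + 1) = fps_of_poly h)"

section \<open>\<open>s\<close>-Eulerian polynomials\<close>

text \<open>The sequence \<open>(s\<^sub>1, s\<^sub>2, \<dots>)\<close> is indexed from 1; the value \<open>s 0\<close> is never used.\<close>

definition lecture_hall_simplex :: "(nat \<Rightarrow> nat) \<Rightarrow> nat \<Rightarrow> (nat \<Rightarrow> real) set" where
  "lecture_hall_simplex s N =
    {x. (\<forall>i. i \<notin> {1..N} \<longrightarrow> x i = 0) \<and>
        0 \<le> x 1 / real (s 1) \<and>
        (\<forall>i\<in>{1..<N}. x i / real (s i) \<le> x (i + 1) / real (s (i + 1))) \<and>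
        x N / real (s N) \<le> 1}"

definition s_eulerian_poly :: "(nat \<Rightarrow> nat) \<Rightarrow> nat \<Rightarrow> int poly" where
  "s_eulerian_poly s N = h_star (lecture_hall_simplex s N)"

definition is_s_eulerian :: "int poly \<Rightarrow> bool" where
  "is_s_eulerian p \<longleftrightarrow>
    (\<exists>s N. (\<forall>i\<ge>1. s i > 0) \<and> N \<ge> 1 \<and> p = s_eulerian_poly s N)"

end

theory Submission
  imports Defs
begin

text \<open>
  If \<open>s\<close> is scaled by \<open>r\<close>, the lecture hall simplex is dilated by \<open>r\<close>. Hence it suffices to find,
  for \<open>r = 1\<close>, a sequence whose simplex has the Ehrhart polynomial \<open>\<Prod>\<^sub>k (t + m\<^sub>k choose m\<^sub>k)\<close>, and
  to show that the colored multiset Eulerian polynomial, divided by \<open>(1 - x)\<^sup>m\<^sup>+\<^sup>1\<close>, is the series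
  \<open>\<Sum>\<^sub>t \<Prod>\<^sub>k (rt + m\<^sub>k choose m\<^sub>k) x\<^sup>t\<close>. The sequences are \<open>(1, 2, 3, \<dots>)\<close> for \<open>\<^bold>m = (1, \<dots>, 1)\<close> and
  \<open>(1, 1, 3, 2, 5, 3, \<dots>)\<close> for the other two vectors. Their lattice points are counted by slicing
  along the last coordinate, which needs closed forms for the counts at all rational dilation
  factors with the denominator of that coordinate. The series is found by inserting barriers at
  the descents of a word: words with \<open>t\<close> barriers correspond to families of multisets, of size
  \<open>m\<^sub>k\<close> in a set of \<open>rt + 1\<close> elements for each \<open>k\<close>.
\<close>

section \<open>Lattice points of lecture hall simplices\<close>

text \<open>The parameter \<open>b\<close> bounds the last coordinate: \<open>b = q * s N\<close>
  gives the \<open>q\<close>-th dilate, other values give the fractional dilation factors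
  \<open>b / s N\<close>. Fractions are cross-multiplied to stay within the natural numbers.\<close>

definition lecture_hall_functions :: "(nat \<Rightarrow> nat) \<Rightarrow> nat \<Rightarrow> nat \<Rightarrow> (nat \<Rightarrow> nat) set" where
  "lecture_hall_functions s N b = {f. (\<forall>i. i \<notin> {1..N} \<longrightarrow> f i = 0) \<and>
     (\<forall>i\<in>{1..<N}. f i * s (Suc i) \<le> f (Suc i) * s i) \<and> f N \<le> b}"

lemma lecture_hall_functions_0: "lecture_hall_functions s 0 b = {\<lambda>_. 0}"
  by (auto simp: lecture_hall_functions_def)

text \<open>Slicing: once the last coordinate is \<open>j\<close>, the final inequality bounds
  coordinate \<open>N\<close> by the floor of \<open>j * s N / s (Suc N)\<close>.\<close>

lemma bij_betw_lecture_hall_functions_Suc: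
  assumes "s (Suc N) > 0"
  shows "bij_betw (\<lambda>f. (f (Suc N), f(Suc N := 0))) (lecture_hall_functions s (Suc N) b)
    (SIGMA j:{..b}. lecture_hall_functions s N (j * s N div s (Suc N)))"
proof (rule bij_betwI[where g = "\<lambda>(j, f). f(Suc N := j)"])
  show "(\<lambda>f. (f (Suc N), f(Suc N := 0))) \<in> lecture_hall_functions s (Suc N) b \<rightarrow>
    (SIGMA j:{..b}. lecture_hall_functions s N (j * s N div s (Suc N)))"
    using assms
    by (cases "N = 0") (auto simp: lecture_hall_functions_def less_eq_div_iff_mult_less_eq)
  show "(\<lambda>(j, f). f(Suc N := j)) \<in>
    (SIGMA j:{..b}. lecture_hall_functions s N (j * s N div s (Suc N))) \<rightarrow> lecture_hall_functions s (Suc N) b"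
    using assms
    by (auto simp: lecture_hall_functions_def less_eq_div_iff_mult_less_eq less_Suc_eq)
qed (auto simp: lecture_hall_functions_def fun_eq_iff)

lemma finite_lecture_hall_functions:
  assumes "\<forall>i\<ge>1. s i > 0"
  shows "finite (lecture_hall_functions s N b)"
proof (induction N arbitrary: b)
  case 0
  then show ?case by (simp add: lecture_hall_functions_0)
next
  case (Suc N)
  then show ?case
    using bij_betw_finite[OF bij_betw_lecture_hall_functions_Suc[of s N b]] assms by auto
qed

lemma card_lecture_hall_functions_Suc:
  assumes "\<forall>i\<ge>1. s i > 0"
  shows "card (lecture_hall_functions s (Suc N) b) =
    (\<Sum>j\<le>b. card (lecture_hall_functions s N (j * s N div s (Suc N))))"
  using bij_betw_same_card[OF bij_betw_lecture_hall_functions_Suc[of s N b]] assms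
  by (simp add: card_SigmaI finite_lecture_hall_functions)

text \<open>The bound is written as \<open>q s\<^sub>N\<^sub>+\<^sub>1 + p\<close> with \<open>p \<le> s\<^sub>N\<^sub>+\<^sub>1\<close>, the value \<open>p = s\<^sub>N\<^sub>+\<^sub>1\<close> being
  included so that the periods can be glued together.\<close>

lemma card_lecture_hall_functions_SucI:
  assumes "\<forall>i\<ge>1. s i > 0"
    and "F 0 0 = 1"
    and glue: "\<And>q. F q (s (Suc N)) = F (Suc q) 0"
    and step: "\<And>q p. p < s (Suc N) \<Longrightarrow>
      F q (Suc p) = F q p +
        card (lecture_hall_functions s N (q * s N + Suc p * s N div s (Suc N)))"
    and "card (lecture_hall_functions s N 0) = 1"
    and "p \<le> s (Suc N)"
  shows "card (lecture_hall_functions s (Suc N) (q * s (Suc N) + p)) = F q p"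
proof -
  let ?S = "s (Suc N)"
  have S: "?S > 0" using assms(1) by simp
  have extend: "card (lecture_hall_functions s (Suc N) (q * ?S + p)) = F q p"
    if "card (lecture_hall_functions s (Suc N) (q * ?S)) = F q 0" "p \<le> ?S" for q p
    using that(2)
  proof (induction p)
    case 0
    then show ?case using that(1) by simp
  next
    case (Suc p)
    \<comment> \<open>Whole periods leave the floor: \<open>q * ?S\<close> contributes exactly
      \<open>q * s N\<close>.\<close>
    have "(Suc (q * ?S + p)) * s N div ?S = (Suc p * s N + ?S * (q * s N)) div ?S"
      by (simp add: algebra_simps)
    also have "\<dots> = q * s N + Suc p * s N div ?S"
      using S by (subst div_mult_self2) auto
    finally show ?case
      using Suc step[of p q]
      by (simp add: card_lecture_hall_functions_Suc[OF assms(1)] del: mult_Suc)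
  qed
  have "card (lecture_hall_functions s (Suc N) (q * ?S)) = F q 0" for q
  proof (induction q)
    case 0
    then show ?case using assms by (simp add: card_lecture_hall_functions_Suc)
  next
    case (Suc q)
    then show ?case using extend[of q ?S] glue by (simp add: add.commute)
  qed
  then show ?thesis using extend assms(6) by blast
qed

section \<open>The sequence 1, 2, 3, ..\<close>

lemma card_lecture_hall_functions_id:
  assumes "p \<le> N"
  shows "card (lecture_hall_functions (\<lambda>i. i) N (q * N + p)) = (q + 1) ^ (N - p) * (q + 2) ^ p"
  using assms
proof (induction N arbitrary: q p)
  case 0
  then show ?case by (simp add: lecture_hall_functions_0)
next
  case (Suc N)
  show ?case
  proof (rule card_lecture_hall_functions_SucI[where s = "\<lambda>i. i" and
        F = "\<lambda>q p. (q + 1) ^ (Suc N - p) * (q + 2) ^ p"])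
    fix q p assume p: "p < Suc N"
    \<comment> \<open>Since \<open>Suc p * N = p * Suc N + (N - p)\<close>, the new slice has
      \<open>(q + 1) ^ (N - p) * (q + 2) ^ p\<close> points; adding it turns one factor
      \<open>q + 1\<close> into \<open>q + 2\<close>.\<close>
    have "Suc p * N div Suc N = p"
      using p by (intro div_nat_eqI) (auto simp: algebra_simps)
    moreover have "Suc N - p = Suc (N - p)" using p by simp
    ultimately show "(q + 1) ^ (Suc N - Suc p) * (q + 2) ^ Suc p =
      (q + 1) ^ (Suc N - p) * (q + 2) ^ p +
      card (lecture_hall_functions (\<lambda>i. i) N (q * N + Suc p * N div Suc N))"
      using Suc.IH[of p q] p by (simp add: algebra_simps)
  qed (use Suc.IH[of 0 0] Suc.prems in auto)
qed

section \<open>The sequence 1, 1, 3, 2, 5, 3, ..\<close>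

definition pair_seq :: "nat \<Rightarrow> nat" where
  "pair_seq i = (if even i then i div 2 else i)"

lemma pair_seq_pos: "\<forall>i\<ge>1. pair_seq i > 0"
  by (auto simp: pair_seq_def elim!: evenE)

lemma Suc_choose_two: "(q + 3) choose 2 = ((q + 2) choose 2) + (q + 2)"
  by (simp add: numeral_eq_Suc)

text \<open>Both sides equal half of \<open>(q + 1) * (q + 2) * (q + 3)\<close>. This is used where
  two consecutive slices together turn one triangular number into the next.\<close>

lemma triangular_mult: "((q + 3) choose 2) * (q + 1) = ((q + 2) choose 2) * (q + 3)"
proof -
  have "2 * ((q + 2) choose 2) = (q + 2) * (q + 1)"
    by (induction q) (simp_all add: numeral_eq_Suc)
  then show ?thesis unfolding Suc_choose_two by (simp add: algebra_simps)
qed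

text \<open>The even case is a hypothesis for the same \<open>i\<close>, since the induction for the
  even case applies this lemma to its own induction hypothesis. The floor is \<open>p div 2\<close>,
  so every slice size occurs twice in a row: the last factor rises from \<open>q + 1\<close> through
  \<open>q + 2\<close> to \<open>q + 3\<close>, where \<open>triangular_mult\<close> resets it to
  \<open>q + 1\<close>.\<close>

lemma card_lecture_hall_functions_pair_seq_odd_aux:
  assumes even: "\<And>q p. p \<le> i \<Longrightarrow> card (lecture_hall_functions pair_seq (2 * i) (q * i + p)) =
      ((q + 2) choose 2) ^ (i - p) * ((q + 3) choose 2) ^ p"
    and "p \<le> 2 * i + 1"
  shows "card (lecture_hall_functions pair_seq (Suc (2 * i)) (q * (2 * i + 1) + p)) =
      ((q + 2) choose 2) ^ (i - p div 2) * ((q + 3) choose 2) ^ (p div 2) * (q + 1 + p mod 2)"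
proof -
  let ?F = "\<lambda>q p. ((q + 2) choose 2) ^ (i - p div 2) * ((q + 3) choose 2) ^ (p div 2) * (q + 1 + p mod 2)"
  have s: "pair_seq (Suc (2 * i)) = 2 * i + 1" "pair_seq (2 * i) = i"
    by (simp_all add: pair_seq_def)
  have "card (lecture_hall_functions pair_seq (Suc (2 * i)) (q * pair_seq (Suc (2 * i)) + p)) = ?F q p"
  proof (rule card_lecture_hall_functions_SucI[OF pair_seq_pos])
    fix q p assume "p < pair_seq (Suc (2 * i))"
    then have p: "p < 2 * i + 1" by (simp add: s)
    have "Suc p * i div (2 * i + 1) = p div 2"
    proof (cases "even p")
      case True
      then obtain a where "p = 2 * a" by blast
      then show ?thesis using p by (intro div_nat_eqI) (auto simp: algebra_simps)
    next
      case False
      then obtain a where "p = 2 * a + 1" using oddE by blast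
      then show ?thesis using p by (intro div_nat_eqI) (auto simp: algebra_simps)
    qed
    then have "card (lecture_hall_functions pair_seq (2 * i)
        (q * pair_seq (2 * i) + Suc p * pair_seq (2 * i) div pair_seq (Suc (2 * i)))) =
        ((q + 2) choose 2) ^ (i - p div 2) * ((q + 3) choose 2) ^ (p div 2)"
      using even[of "p div 2" q] p by (simp add: s)
    moreover have "?F q (Suc p) = ?F q p + ((q + 2) choose 2) ^ (i - p div 2) * ((q + 3) choose 2) ^ (p div 2)"
    proof (cases "even p")
      case True
      then obtain a where "p = 2 * a" by blast
      then show ?thesis by simp
    next
      case False
      then obtain a where a: "p = 2 * a + 1" using oddE by blast
      \<comment> \<open>For odd \<open>p\<close> the bound forces \<open>a < i\<close>, so a factor
        \<open>?c\<close> is left to be exchanged for \<open>?d\<close>.\<close>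
      then have "i - a = Suc (i - Suc a)" using p by simp
      let ?c = "(q + 2) choose 2" and ?d = "(q + 3) choose 2"
      let ?X = "?c ^ (i - Suc a) * ?d ^ a"
      have "?F q p = ?X * (?c * (q + 2))"
      proof -
        have "p div 2 = a" "q + 1 + p mod 2 = q + 2" using a by simp_all
        then show ?thesis using \<open>i - a = _\<close> by (simp only: power_Suc mult_ac)
      qed
      moreover have "?F q (Suc p) = ?X * (?c * (q + 3))"
      proof -
        have "Suc p div 2 = Suc a" "q + 1 + Suc p mod 2 = q + 1" using a by simp_all
        moreover have "?X * (?d * (q + 1)) = ?X * (?c * (q + 3))" by (simp only: triangular_mult)
        ultimately show ?thesis by (simp only: power_Suc mult_ac)
      qed
      moreover have "?c ^ (i - p div 2) * ?d ^ (p div 2) = ?X * ?c"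
        using a \<open>i - a = _\<close> by simp
      moreover have "?X * (?c * (q + 3)) = ?X * (?c * (q + 2)) + ?X * ?c"
      proof -
        have "?c * (q + 3) = ?c * (q + 2) + ?c" by (simp add: algebra_simps)
        then show ?thesis by (simp only: distrib_left)
      qed
      ultimately show ?thesis by argo
    qed
    ultimately show "?F q (Suc p) = ?F q p + card (lecture_hall_functions pair_seq (2 * i)
        (q * pair_seq (2 * i) + Suc p * pair_seq (2 * i) div pair_seq (Suc (2 * i))))"
      by simp
  next
    show "?F q (pair_seq (Suc (2 * i))) = ?F (Suc q) 0" for q
      by (simp only: s) (simp add: numeral_3_eq_3)
    show "card (lecture_hall_functions pair_seq (2 * i) 0) = 1"
      using even[of 0 0] by (simp add: numeral_2_eq_2)
  qed (use assms(2) in \<open>simp_all only: s, simp_all add: numeral_2_eq_2\<close>)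
  then show ?thesis by (simp add: s)
qed

text \<open>The slice sizes come from the odd case at \<open>2 * p + 1\<close>. Its last factor
  \<open>q + 2\<close> is the difference of the two consecutive triangular numbers, so each slice
  replaces one of them by the next.\<close>

lemma card_lecture_hall_functions_pair_seq_even:
  assumes "p \<le> i"
  shows "card (lecture_hall_functions pair_seq (2 * i) (q * i + p)) =
      ((q + 2) choose 2) ^ (i - p) * ((q + 3) choose 2) ^ p"
  using assms
proof (induction i arbitrary: q p)
  case 0
  then show ?case by (simp add: lecture_hall_functions_0)
next
  case (Suc i)
  let ?F = "\<lambda>q p. ((q + 2) choose 2) ^ (Suc i - p) * ((q + 3) choose 2) ^ p"
  let ?N = "Suc (2 * i)"
  note odd = card_lecture_hall_functions_pair_seq_odd_aux[OF Suc.IH]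
  have s: "pair_seq (Suc ?N) = Suc i" "pair_seq ?N = 2 * i + 1"
    by (simp_all add: pair_seq_def)
  have "card (lecture_hall_functions pair_seq (Suc ?N) (q * pair_seq (Suc ?N) + p)) = ?F q p"
  proof (rule card_lecture_hall_functions_SucI[OF pair_seq_pos])
    fix q p assume "p < pair_seq (Suc ?N)"
    then have p: "p \<le> i" by (simp add: s)
    have "Suc p * (2 * i + 1) div Suc i = 2 * p + 1"
      using p by (intro div_nat_eqI) (auto simp: algebra_simps)
    then have "card (lecture_hall_functions pair_seq ?N
        (q * pair_seq ?N + Suc p * pair_seq ?N div pair_seq (Suc ?N))) =
        ((q + 2) choose 2) ^ (i - p) * ((q + 3) choose 2) ^ p * (q + 2)"
      using odd[of "2 * p + 1" q] p by (simp add: s)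
    moreover have "Suc i - p = Suc (i - p)" using p by simp
    ultimately show "?F q (Suc p) = ?F q p + card (lecture_hall_functions pair_seq ?N
        (q * pair_seq ?N + Suc p * pair_seq ?N div pair_seq (Suc ?N)))"
      using Suc_choose_two[of q] by (simp add: algebra_simps)
  next
    show "?F q (pair_seq (Suc ?N)) = ?F (Suc q) 0" for q
      by (simp only: s) (simp add: numeral_3_eq_3)
    show "card (lecture_hall_functions pair_seq ?N 0) = 1"
      using odd[of 0 0] by (simp add: numeral_2_eq_2)
  qed (use Suc.prems in \<open>simp_all only: s, simp_all add: numeral_2_eq_2\<close>)
  then show ?case by (simp add: s)
qed

lemmas card_lecture_hall_functions_pair_seq_odd =
  card_lecture_hall_functions_pair_seq_odd_aux[OF card_lecture_hall_functions_pair_seq_even]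

section \<open>From lattice points to the Ehrhart series\<close>

lemma lattice_points_scaled_lecture_hall_simplex:
  assumes s: "\<forall>i\<ge>1. s i > 0" and "r > 0" "N > 0" "t > 0"
  shows "lattice_points ((\<lambda>x. real t *\<^sub>R x) ` lecture_hall_simplex (\<lambda>i. r * s i) N) =
    (\<lambda>f i. real (f i)) ` lecture_hall_functions s N (r * t * s N)"
proof (intro equalityI subsetI)
  fix x assume "x \<in> lattice_points ((\<lambda>x. real t *\<^sub>R x) ` lecture_hall_simplex (\<lambda>i. r * s i) N)"
  then obtain y where y: "y \<in> lecture_hall_simplex (\<lambda>i. r * s i) N"
    and xy: "\<And>i. x i = real t * y i" and int: "\<And>i. x i \<in> \<int>"
    by (auto simp: lattice_points_def scaleR_fun_def)
  have y0: "y i = 0" if "i \<notin> {1..N}" for i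
    using y that by (auto simp: lecture_hall_simplex_def)
  have ystep: "y i * real (s (Suc i)) \<le> y (Suc i) * real (s i)" if "i \<in> {1..<N}" for i
  proof -
    have "y i / real (r * s i) \<le> y (Suc i) / real (r * s (Suc i))"
      using y that by (auto simp: lecture_hall_simplex_def)
    then have "y i / real (s i) \<le> y (Suc i) / real (s (Suc i))"
      using assms by (simp add: divide_simps mult_ac)
    then show ?thesis using s that by (auto simp: divide_simps mult_ac)
  qed
  have yN: "y N \<le> real (r * s N)"
    using y assms by (auto simp: lecture_hall_simplex_def divide_simps)
  \<comment> \<open>Only the first coordinate is bounded below directly; the chain of inequalities
    carries the sign upwards, which permits the passage to natural numbers.\<close>
  have nonneg: "y i \<ge> 0" for i
  proof (induction i)
    case 0
    then show ?case using y0[of 0] by simp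
  next
    case (Suc i)
    consider "Suc i = 1" | "i \<in> {1..<N}" | "Suc i \<notin> {1..N}" by fastforce
    then show ?case
    proof cases
      case 1
      have "0 \<le> y 1 / real (r * s 1)" using y by (auto simp: lecture_hall_simplex_def)
      moreover have "real (r * s 1) > 0" using assms by simp
      ultimately show ?thesis using 1 by (simp only: zero_le_divide_iff) auto
    next
      case 2
      then have "0 \<le> y (Suc i) * real (s i)"
        using ystep[OF 2] Suc by (meson mult_nonneg_nonneg of_nat_0_le_iff order_trans)
      moreover have "s i > 0" using s 2 by simp
      ultimately show ?thesis by (simp add: zero_le_mult_iff)
    qed (simp add: y0)
  qed
  define f where "f i = nat \<lfloor>x i\<rfloor>" for i
  have xf: "x i = real (f i)" for i
  proof -
    obtain k where "x i = of_int k" using int[of i] by (auto elim: Ints_cases)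
    moreover have "x i \<ge> 0" using xy nonneg by simp
    ultimately show ?thesis by (simp add: f_def)
  qed
  have "f i * s (Suc i) \<le> f (Suc i) * s i" if "i \<in> {1..<N}" for i
  proof -
    have "real t * (y i * real (s (Suc i))) \<le> real t * (y (Suc i) * real (s i))"
      using ystep[OF that] by (rule mult_left_mono) simp
    then have "real (f i * s (Suc i)) \<le> real (f (Suc i) * s i)"
      using xf xy by (simp add: mult_ac flip: xf)
    then show ?thesis using of_nat_le_iff by blast
  qed
  moreover have "f i = 0" if "i \<notin> {1..N}" for i
    using xy y0[OF that] by (simp add: f_def)
  moreover have "f N \<le> r * t * s N"
  proof -
    have "real t * y N \<le> real t * real (r * s N)"
      using yN by (rule mult_left_mono) simp
    then have "real (f N) \<le> real (r * t * s N)"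
      using xf xy by (simp add: mult_ac flip: xf)
    then show ?thesis using of_nat_le_iff by blast
  qed
  ultimately have "f \<in> lecture_hall_functions s N (r * t * s N)"
    by (simp add: lecture_hall_functions_def)
  then show "x \<in> (\<lambda>f i. real (f i)) ` lecture_hall_functions s N (r * t * s N)"
    using xf by (intro image_eqI[of _ _ f]) auto
next
  fix x assume "x \<in> (\<lambda>f i. real (f i)) ` lecture_hall_functions s N (r * t * s N)"
  then obtain f where f: "f \<in> lecture_hall_functions s N (r * t * s N)" and x: "x = (\<lambda>i. real (f i))"
    by blast
  have "(\<lambda>i. x i / real t) \<in> lecture_hall_simplex (\<lambda>i. r * s i) N"
    unfolding lecture_hall_simplex_def
  proof (intro CollectI conjI allI ballI impI)
    fix i assume i: "i \<in> {1..<N}"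
    then have "f i * s (Suc i) \<le> f (Suc i) * s i"
      using f by (auto simp: lecture_hall_functions_def)
    then have le: "real (f i) * real (s (Suc i)) \<le> real (f (Suc i)) * real (s i)"
      by (metis of_nat_le_iff of_nat_mult)
    moreover have pos: "s i > 0" "s (Suc i) > 0" using s i by auto
    ultimately have "real (f i) / real (s i) \<le> real (f (Suc i)) / real (s (Suc i))"
      by (simp add: divide_simps mult_ac)
    then have "real (f i) / real (s i) / (real r * real t) \<le> real (f (Suc i)) / real (s (Suc i)) / (real r * real t)"
      by (rule divide_right_mono) simp
    then show "x i / real t / real (r * s i) \<le> x (i + 1) / real t / real (r * s (i + 1))"
      by (simp add: x mult_ac)
  next
    have "f N \<le> r * t * s N" using f by (auto simp: lecture_hall_functions_def)
    then have "real (f N) \<le> real r * real t * real (s N)"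
      by (metis of_nat_le_iff of_nat_mult)
    then show "x N / real t / real (r * s N) \<le> 1"
      using assms by (simp add: x divide_simps mult_ac)
  qed (use f in \<open>auto simp: x lecture_hall_functions_def\<close>)
  then have "x \<in> (\<lambda>x. real t *\<^sub>R x) ` lecture_hall_simplex (\<lambda>i. r * s i) N"
    using assms by (intro image_eqI[of _ _ "\<lambda>i. x i / real t"]) (auto simp: scaleR_fun_def)
  then show "x \<in> lattice_points ((\<lambda>x. real t *\<^sub>R x) ` lecture_hall_simplex (\<lambda>i. r * s i) N)"
    by (auto simp: lattice_points_def x)
qed

lemma ehrhart_count_lecture_hall_simplex:
  assumes "\<forall>i\<ge>1. s i > 0" and "r > 0" "N > 0" "t > 0"
  shows "ehrhart_count (lecture_hall_simplex (\<lambda>i. r * s i) N) t =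
    card (lecture_hall_functions s N (r * t * s N))"
proof -
  have "inj (\<lambda>f i. real (f i))" by (auto simp: inj_def fun_eq_iff)
  then show ?thesis
    unfolding ehrhart_count_def lattice_points_scaled_lecture_hall_simplex[OF assms]
    by (intro card_image) (rule inj_on_subset, auto)
qed

lemma sum_fun_eval: "sum f A i = (\<Sum>a\<in>A. f a i)"
  by (induction A rule: infinite_finite_induct) auto

text \<open>The vertices of the simplex are \<open>(0, \<dots>, 0, s\<^sub>k, \<dots>, s\<^sub>N)\<close>; the differences of consecutive
  ones are the multiples \<open>s\<^sub>k e\<^sub>k\<close> of the unit vectors.\<close>

lemma affine_dimension_lecture_hall_simplex:
  assumes s: "\<forall>i\<ge>1. s i > 0" and "N > 0"
  shows "affine_dimension (lecture_hall_simplex s N) = N"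
proof -
  let ?P = "lecture_hall_simplex s N"
  let ?V = "{x - y | x y. x \<in> ?P \<and> y \<in> ?P}"
  define v where "v k = (\<lambda>i. if k \<le> i \<and> i \<le> N then real (s i) else 0)" for k
  define e where "e k = (\<lambda>i. if i = k then real (s k) else 0)" for k
  have inj: "inj_on e {1..N}"
  proof (rule inj_onI)
    fix j k assume "j \<in> {1..N}" "e j = e k"
    then have "s j > 0" "e j j = e k j" using s by simp_all
    then show "j = k"
      by (cases "j = k") (simp_all add: e_def)
  qed
  have vP: "v k \<in> ?P" if "k \<ge> 1" for k
    unfolding lecture_hall_simplex_def
    using that s assms(2) by (auto simp: v_def)
  show ?thesis unfolding affine_dimension_def
  proof (rule dim_unique)
    show "e ` {1..N} \<subseteq> ?V"
    proof safe
      fix k assume "k \<in> {1..N}"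
      \<comment> \<open>For \<open>k = N\<close> the second vector \<open>v (Suc N)\<close> is the
        zero vertex.\<close>
      then have "e k = v k - v (Suc k)" by (auto simp: e_def v_def fun_eq_iff)
      then show "\<exists>x y. e k = x - y \<and> x \<in> ?P \<and> y \<in> ?P"
        using vP[of k] vP[of "Suc k"] \<open>k \<in> {1..N}\<close> by auto
    qed
    show "?V \<subseteq> span (e ` {1..N})"
    proof
      fix z assume "z \<in> ?V"
      then have z: "z i = 0" if "i \<notin> {1..N}" for i
        using that by (auto simp: lecture_hall_simplex_def)
      have "z = (\<Sum>k\<in>{1..N}. (z k / real (s k)) *\<^sub>R e k)"
      proof
        fix i
        have "(\<Sum>k\<in>{1..N}. (z k / real (s k)) *\<^sub>R e k) i =
          (\<Sum>k\<in>{1..N}. if i = k then z k / real (s k) * real (s k) else 0)"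
          unfolding sum_fun_eval by (intro sum.cong) (auto simp: scaleR_fun_def e_def)
        also have "\<dots> = z i" using s z[of i] by auto
        finally show "z i = (\<Sum>k\<in>{1..N}. (z k / real (s k)) *\<^sub>R e k) i" ..
      qed
      also have "\<dots> \<in> span (e ` {1..N})"
        by (intro span_sum span_scale span_base) auto
      finally show "z \<in> span (e ` {1..N})" .
    qed
    show "independent (e ` {1..N})"
    proof (rule independent_if_scalars_zero)
      fix c x assume eq: "(\<Sum>x\<in>e ` {1..N}. c x *\<^sub>R x) = 0" and "x \<in> e ` {1..N}"
      then obtain k where k: "k \<in> {1..N}" "x = e k" by blast
      have "0 = (\<Sum>j\<in>{1..N}. c (e j) *\<^sub>R e j) k"
        using eq inj by (simp add: sum.reindex)
      also have "\<dots> = (\<Sum>j\<in>{1..N}. if k = j then c (e j) * real (s j) else 0)"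
        unfolding sum_fun_eval by (intro sum.cong) (auto simp: scaleR_fun_def e_def)
      also have "\<dots> = c (e k) * real (s k)" using k by simp
      finally show "c x = 0" using s k by auto
    qed simp
    show "card (e ` {1..N}) = N" using inj by (simp add: card_image)
  qed
qed

text \<open>The series in \<open>h_star\<close> has constant term 1, which is why the count at bound
  0 must be 1. Injectivity of \<open>fps_of_poly\<close> gives uniqueness for the definite
  description.\<close>

lemma s_eulerian_poly_eqI:
  assumes s: "\<forall>i\<ge>1. s i > 0" and "r > 0" "N > 0"
    and h: "fps_of_poly h =
      Abs_fps (\<lambda>t. int (card (lecture_hall_functions s N (r * t * s N)))) * (1 - fps_X) ^ Suc N"
    and "card (lecture_hall_functions s N 0) = 1"
  shows "s_eulerian_poly (\<lambda>i. r * s i) N = h"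
proof -
  let ?P = "lecture_hall_simplex (\<lambda>i. r * s i) N"
  have rs: "\<forall>i\<ge>1. r * s i > 0" using assms by auto
  have "1 + Abs_fps (\<lambda>t. if t > 0 then int (ehrhart_count ?P t) else 0) =
      Abs_fps (\<lambda>t. int (card (lecture_hall_functions s N (r * t * s N))))"
    using assms by (auto simp: fps_eq_iff ehrhart_count_lecture_hall_simplex)
  then show ?thesis
    unfolding s_eulerian_poly_def h_star_def
      affine_dimension_lecture_hall_simplex[OF rs \<open>N > 0\<close>]
    using h by (auto intro!: the_equality simp: fps_of_poly_eq_iff)
qed

section \<open>Barred words\<close>

text \<open>Counterpart of \<open>des\<close> for words of ranks. The appended letter is a parameter
  because peeling off the last letter puts that letter in its place.\<close>

definition rank_des :: "nat list \<Rightarrow> nat \<Rightarrow> nat" where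
  "rank_des w b = card {j. j < length w \<and> (w @ [b]) ! Suc j < (w @ [b]) ! j}"

lemma rank_des_le_length: "rank_des w b \<le> length w"
proof -
  have "rank_des w b \<le> card {..<length w}"
    unfolding rank_des_def by (rule card_mono) auto
  then show ?thesis by simp
qed

lemma rank_des_snoc: "rank_des (w @ [a]) b = rank_des w a + (if b < a then 1 else 0)"
proof -
  have "{j. j < length (w @ [a]) \<and> ((w @ [a]) @ [b]) ! Suc j < ((w @ [a]) @ [b]) ! j} =
    {j. j < length w \<and> (w @ [a]) ! Suc j < (w @ [a]) ! j} \<union> (if b < a then {length w} else {})"
    by (auto simp: nth_append less_Suc_eq split: if_splits)
  then show ?thesis unfolding rank_des_def
    by (auto simp: card_Un_disjoint)
qed

text \<open>Hockey-stick identity; \<open>d \<le> m\<close> keeps the truncated subtraction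
  exact.\<close>

lemma sum_choose_shifted:
  assumes "d \<le> m"
  shows "(\<Sum>u<t. (u + m - d) choose m) = (t + m - d) choose Suc m"
proof (induction t)
  case 0
  then show ?case by (simp add: binomial_eq_0)
next
  case (Suc t)
  have "Suc t + m - d = Suc (t + m - d)" using assms by simp
  then show ?case using Suc by simp
qed

text \<open>An entry \<open>u * R + a\<close> stands for the letter \<open>a\<close> with
  \<open>u\<close> barriers to its left. Sortedness forces a barrier at every descent; a bound
  \<open>t * R + c\<close> with \<open>c < R\<close> does the same in front of the appended letter
  \<open>c\<close> and fixes the total at \<open>t\<close>.\<close>

definition sorted_lifts :: "nat \<Rightarrow> nat list \<Rightarrow> nat \<Rightarrow> nat list set" where
  "sorted_lifts R w b = {xs. sorted xs \<and> map (\<lambda>x. x mod R) xs = w \<and> (\<forall>x\<in>set xs. x \<le> b)}"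

lemma sorted_lifts_snoc:
  assumes "a < R"
  shows "sorted_lifts R (w @ [a]) b =
    (\<Union>u\<in>{u. u * R + a \<le> b}. (\<lambda>xs. xs @ [u * R + a]) ` sorted_lifts R w (u * R + a))"
proof (intro equalityI subsetI)
  fix ys assume ys: "ys \<in> sorted_lifts R (w @ [a]) b"
  then obtain xs x where x: "ys = xs @ [x]" "map (\<lambda>x. x mod R) xs = w" "x mod R = a"
    by (auto simp: sorted_lifts_def map_eq_append_conv)
  then have x_eq: "x = x div R * R + a" by (metis div_mult_mod_eq)
  moreover have "xs \<in> sorted_lifts R w x" "x \<le> b"
    using ys x by (auto simp: sorted_lifts_def sorted_append)
  ultimately show "ys \<in> (\<Union>u\<in>{u. u * R + a \<le> b}. (\<lambda>xs. xs @ [u * R + a]) ` sorted_lifts R w (u * R + a))"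
    using x x_eq by (intro UN_I[of "x div R"]) auto
qed (use assms in \<open>force simp: sorted_lifts_def sorted_append\<close>)

lemma finite_sorted_lifts: "finite (sorted_lifts R w b)"
proof (rule finite_subset)
  show "sorted_lifts R w b \<subseteq> {xs. set xs \<subseteq> {..b} \<and> length xs = length w}"
    by (auto simp: sorted_lifts_def)
qed (simp add: finite_lists_length_eq)

text \<open>With \<open>d\<close> descents, \<open>d\<close> barriers are forced and the other
  \<open>t - d\<close> are distributed freely over \<open>length w + 1\<close> gaps; for
  \<open>t < d\<close> the binomial is 0. The induction sums over the number \<open>u\<close> of
  barriers before the last letter.\<close>

lemma card_sorted_lifts:
  assumes "set w \<subseteq> {..<R}" "b < R"
  shows "card (sorted_lifts R w (t * R + b)) = (t + length w - rank_des w b) choose length w"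
  using assms
proof (induction w arbitrary: b t rule: rev_induct)
  case Nil
  have "sorted_lifts R [] (t * R + b) = {[]}" by (auto simp: sorted_lifts_def)
  then show ?case by simp
next
  case (snoc a w)
  \<comment> \<open>\<open>T\<close> is the number of admissible \<open>u\<close>: the value
    \<open>u = t\<close> is excluded exactly if the step from \<open>a\<close> to \<open>b\<close>
    is a descent.\<close>
  define T where "T = (if b < a then t else Suc t)"
  have a: "a < R" using snoc.prems by simp
  have "{u. u * R + a \<le> t * R + b} = {..<T}"
  proof (intro equalityI subsetI CollectI)
    fix u assume "u \<in> {..<T}"
    then consider "u < t" | "u = t" "\<not> b < a" 
      by (cases "u = t") (auto simp: T_def split: if_splits)
    then show "u * R + a \<le> t * R + b"
    proof cases
      case 1
      then have "Suc u * R \<le> t * R" by (intro mult_le_mono1) simp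
      then show ?thesis using a by simp
    qed simp
  next
    fix u assume u: "u \<in> {u. u * R + a \<le> t * R + b}"
    have "\<not> t < u"
    proof
      assume "t < u"
      then have "Suc t * R \<le> u * R" by (intro mult_le_mono1) simp
      then show False using u snoc.prems by simp
    qed
    then show "u \<in> {..<T}" using u by (cases "u = t") (auto simp: T_def)
  qed
  then have "card (sorted_lifts R (w @ [a]) (t * R + b)) =
      card (\<Union>u<T. (\<lambda>xs. xs @ [u * R + a]) ` sorted_lifts R w (u * R + a))"
    using sorted_lifts_snoc[OF a] by simp
  also have "\<dots> = (\<Sum>u<T. card ((\<lambda>xs. xs @ [u * R + a]) ` sorted_lifts R w (u * R + a)))"
    using a by (intro card_UN_disjoint) (auto simp: finite_sorted_lifts)
  also have "\<dots> = (\<Sum>u<T. card (sorted_lifts R w (u * R + a)))"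
    by (intro sum.cong refl card_image) (simp add: inj_on_def)
  also have "\<dots> = (\<Sum>u<T. (u + length w - rank_des w a) choose length w)"
    using snoc by simp
  also have "\<dots> = (T + length w - rank_des w a) choose Suc (length w)"
    by (rule sum_choose_shifted) (rule rank_des_le_length)
  finally show ?case
    by (simp add: T_def rank_des_snoc)
qed

section \<open>Binomial series\<close>

lemma fps_choose_power:
  "Abs_fps (\<lambda>t. of_nat ((t + m) choose m)) * (1 - fps_X) ^ Suc m = (1 :: 'a :: comm_ring_1 fps)"
proof (induction m)
  case 0
  have "Abs_fps (\<lambda>_. 1) * (1 - fps_X) = (1 :: 'a fps)"
    by (auto simp: fps_eq_iff right_diff_distrib)
  then show ?case by simp
next
  case (Suc m)
  \<comment> \<open>Multiplication by \<open>1 - fps_X\<close> takes differences of consecutive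
    coefficients, so this is Pascal's rule.\<close>
  have "Abs_fps (\<lambda>t. of_nat ((t + Suc m) choose Suc m)) * (1 - fps_X) =
      (Abs_fps (\<lambda>t. of_nat ((t + m) choose m)) :: 'a fps)"
  proof (rule fps_ext)
    fix k
    show "fps_nth (Abs_fps (\<lambda>t. of_nat ((t + Suc m) choose Suc m)) * (1 - fps_X)) k =
      fps_nth (Abs_fps (\<lambda>t. of_nat ((t + m) choose m)) :: 'a fps) k"
      by (cases k) (simp_all add: right_diff_distrib binomial_eq_0)
  qed
  then show ?case using Suc by (simp only: power_Suc[of _ "Suc m"] flip: mult.assoc)
qed

text \<open>Generating function for the barred versions of a single word with \<open>d\<close>
  descents; the coefficients below degree \<open>d\<close> vanish.\<close>

lemma fps_shifted_choose_power:
  assumes "d \<le> m"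
  shows "Abs_fps (\<lambda>t. of_nat ((t + m - d) choose m)) * (1 - fps_X) ^ Suc m =
    (fps_X ^ d :: 'a :: comm_ring_1 fps)"
proof -
  have "Abs_fps (\<lambda>t. of_nat ((t + m - d) choose m)) =
      (fps_X ^ d * Abs_fps (\<lambda>t. of_nat ((t + m) choose m)) :: 'a fps)"
    using assms by (auto simp: fps_eq_iff fps_X_power_mult_nth binomial_eq_0)
  then show ?thesis using fps_choose_power[of m] by (metis mult.assoc mult.right_neutral)
qed

section \<open>Multisets and residue classes\<close>

lemma card_multisets_with_sizes:
  assumes "finite K" "disjoint_family_on A K"
  shows "card {M. set_mset M \<subseteq> (\<Union>k\<in>K. A k) \<and> (\<forall>k\<in>K. size (filter_mset (\<lambda>x. x \<in> A k) M) = \<mu> k)} =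
    (\<Prod>k\<in>K. card (multisets_of_size (A k) (\<mu> k)))"
  using assms
proof (induction K rule: finite_induct)
  case empty
  have "{M :: 'b multiset. set_mset M \<subseteq> {}} = {{#}}" by auto
  then show ?case by simp
next
  case (insert l K)
  let ?S = "\<lambda>K. {M. set_mset M \<subseteq> (\<Union>k\<in>K. A k) \<and> (\<forall>k\<in>K. size (filter_mset (\<lambda>x. x \<in> A k) M) = \<mu> k)}"
  have disj: "A l \<inter> A k = {}" if "k \<in> K" for k
    using insert that by (auto simp: disjoint_family_on_def)
  \<comment> \<open>A multiset splits into its part in \<open>A l\<close> and the rest; disjointness
    makes the two choices independent.\<close>
  have "bij_betw (\<lambda>(L, M). L + M) (multisets_of_size (A l) (\<mu> l) \<times> ?S K) (?S (insert l K))"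
  proof (rule bij_betwI[where g = "\<lambda>M. (filter_mset (\<lambda>x. x \<in> A l) M, filter_mset (\<lambda>x. x \<notin> A l) M)"])
    have 1: "filter_mset (\<lambda>x. x \<in> A l) L = L" "filter_mset (\<lambda>x. x \<notin> A l) L = {#}"
      if "set_mset L \<subseteq> A l" for L
      using that by (auto simp: filter_mset_eq_conv)
    have 2: "filter_mset (\<lambda>x. x \<in> A l) M = {#}" "filter_mset (\<lambda>x. x \<notin> A l) M = M"
      if "set_mset M \<subseteq> (\<Union>k\<in>K. A k)" for M
      using that disj by (auto simp: filter_mset_eq_conv)
    have 3: "filter_mset (\<lambda>x. x \<in> A k) L = {#}" if "set_mset L \<subseteq> A l" "k \<in> K" for L k
      using that disj by (auto simp: filter_mset_eq_conv)
    show "(\<lambda>(L, M). L + M) \<in> multisets_of_size (A l) (\<mu> l) \<times> ?S K \<rightarrow> ?S (insert l K)"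
    proof (intro funcsetI)
      fix p assume "p \<in> multisets_of_size (A l) (\<mu> l) \<times> ?S K"
      then obtain L M where p: "p = (L, M)" and L: "set_mset L \<subseteq> A l" "size L = \<mu> l"
        and M: "set_mset M \<subseteq> (\<Union>k\<in>K. A k)" "\<forall>k\<in>K. size (filter_mset (\<lambda>x. x \<in> A k) M) = \<mu> k"
        by (auto simp: multisets_of_size_def)
      then show "(case p of (L, M) \<Rightarrow> L + M) \<in> ?S (insert l K)"
        using 1[OF L(1)] 2[OF M(1)] 3[OF L(1)] by auto
    qed
    show "(\<lambda>M. (filter_mset (\<lambda>x. x \<in> A l) M, filter_mset (\<lambda>x. x \<notin> A l) M))
        \<in> ?S (insert l K) \<rightarrow> multisets_of_size (A l) (\<mu> l) \<times> ?S K"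
    proof (intro funcsetI)
      fix M assume M: "M \<in> ?S (insert l K)"
      have "filter_mset (\<lambda>x. x \<in> A k) (filter_mset (\<lambda>x. x \<notin> A l) M) = filter_mset (\<lambda>x. x \<in> A k) M"
        if "k \<in> K" for k
        using disj[OF that] by (auto simp: filter_filter_mset intro!: filter_mset_cong)
      then show "(filter_mset (\<lambda>x. x \<in> A l) M, filter_mset (\<lambda>x. x \<notin> A l) M) \<in>
          multisets_of_size (A l) (\<mu> l) \<times> ?S K"
        using M by (auto simp: multisets_of_size_def)
    qed
    show "(\<lambda>M. (filter_mset (\<lambda>x. x \<in> A l) M, filter_mset (\<lambda>x. x \<notin> A l) M)) (case p of (L, M) \<Rightarrow> L + M) = p"
      if "p \<in> multisets_of_size (A l) (\<mu> l) \<times> ?S K" for p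
    proof -
      obtain L M where p: "p = (L, M)" "set_mset L \<subseteq> A l" "set_mset M \<subseteq> (\<Union>k\<in>K. A k)"
        using \<open>p \<in> _\<close> by (auto simp: multisets_of_size_def)
      show ?thesis using 1[OF p(2)] 2[OF p(3)] by (simp add: p(1))
    qed
    show "(case (filter_mset (\<lambda>x. x \<in> A l) M, filter_mset (\<lambda>x. x \<notin> A l) M) of (L, M) \<Rightarrow> L + M) = M" for M
      unfolding prod.case by (rule multiset_partition[symmetric])
  qed
  from bij_betw_same_card[OF this]
  have "card (?S (insert l K)) = card (multisets_of_size (A l) (\<mu> l)) * card (?S K)"
    by (simp only: card_cartesian_product)
  then show ?case
    using insert by (simp add: disjoint_family_on_def)
qed

definition sorted_with_residues :: "nat \<Rightarrow> (nat \<Rightarrow> nat) \<Rightarrow> nat \<Rightarrow> nat list set" where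
  "sorted_with_residues n \<mu> q = {xs. sorted xs \<and> set xs \<subseteq> {..<n * Suc q} \<and>
     (\<forall>k<n. length (filter (\<lambda>x. x mod n = k) xs) = \<mu> k)}"

text \<open>Sorted lists represent multisets, which split along the residue classes modulo
  \<open>n\<close>. The bound \<open>n * Suc q\<close> leaves exactly \<open>q + 1\<close> numbers
  in each class.\<close>

lemma card_sorted_with_residues:
  assumes "n > 0"
  shows "card (sorted_with_residues n \<mu> q) = (\<Prod>k<n. (q + \<mu> k) choose \<mu> k)"
proof -
  define A where "A k = {x. x < n * Suc q \<and> x mod n = k}" for k
  let ?S = "{M. set_mset M \<subseteq> (\<Union>k<n. A k) \<and> (\<forall>k\<in>{..<n}. size (filter_mset (\<lambda>x. x \<in> A k) M) = \<mu> k)}"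
  have UN: "(\<Union>k<n. A k) = {..<n * Suc q}" using assms by (auto simp: A_def)
  have size: "size (filter_mset (\<lambda>x. x \<in> A k) (mset xs)) = length (filter (\<lambda>x. x mod n = k) xs)"
    if "set xs \<subseteq> {..<n * Suc q}" for xs k
  proof -
    have "filter (\<lambda>x. x \<in> A k) xs = filter (\<lambda>x. x mod n = k) xs"
      using that by (intro filter_cong) (auto simp: A_def)
    then show ?thesis by (simp flip: mset_filter)
  qed
  have "bij_betw mset (sorted_with_residues n \<mu> q) ?S"
  proof (rule bij_betwI[where g = sorted_list_of_multiset])
    show "mset \<in> sorted_with_residues n \<mu> q \<rightarrow> ?S"
      unfolding UN by (auto simp: sorted_with_residues_def size)
    show "sorted_list_of_multiset \<in> ?S \<rightarrow> sorted_with_residues n \<mu> q"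
    proof
      fix M assume M: "M \<in> ?S"
      then have "set (sorted_list_of_multiset M) \<subseteq> {..<n * Suc q}" unfolding UN by simp
      then show "sorted_list_of_multiset M \<in> sorted_with_residues n \<mu> q"
        using M size[of "sorted_list_of_multiset M"] by (simp add: sorted_with_residues_def)
    qed
  qed (auto simp: sorted_with_residues_def sorted_sort_id)
  then have "card (sorted_with_residues n \<mu> q) = card ?S" by (rule bij_betw_same_card)
  also have "\<dots> = (\<Prod>k<n. card (multisets_of_size (A k) (\<mu> k)))"
    by (rule card_multisets_with_sizes) (auto simp: disjoint_family_on_def A_def)
  also have "\<dots> = (\<Prod>k<n. (q + \<mu> k) choose \<mu> k)"
  proof (intro prod.cong refl)
    fix k assume k: "k \<in> {..<n}"
    have "bij_betw (\<lambda>v. v * n + k) {..q} (A k)"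
    proof (rule bij_betwI[where g = "\<lambda>x. x div n"])
      show "(\<lambda>v. v * n + k) \<in> {..q} \<rightarrow> A k"
      proof
        fix v assume "v \<in> {..q}"
        then have "v * n \<le> q * n" by simp
        moreover have "k < n" using k by simp
        ultimately have "v * n + k < n + q * n" by linarith
        then show "v * n + k \<in> A k" using k by (simp add: A_def mult.commute)
      qed
    qed (use k in \<open>auto simp: A_def less_mult_imp_div_less mult.commute less_Suc_eq_le[symmetric]\<close>)
    then have "card (A k) = Suc q" using bij_betw_same_card by fastforce
    moreover have "finite (A k)" by (simp add: A_def)
    ultimately show "card (multisets_of_size (A k) (\<mu> k)) = (q + \<mu> k) choose \<mu> k"
      by (simp add: card_multisets_of_size)
  qed
  finally show ?thesis .
qed

section \<open>Colored letters and their ranks\<close>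

lemma sum_count_list_eq_length_filter:
  "finite K \<Longrightarrow> (\<Sum>k\<in>K. count_list xs k) = length (filter (\<lambda>x. x \<in> K) xs)"
proof (induction xs)
  case (Cons x xs)
  have "(\<Sum>k\<in>K. count_list (x # xs) k) = (\<Sum>k\<in>K. count_list xs k + (if k = x then 1 else 0))"
    by (intro sum.cong) auto
  then show ?case using Cons by (simp add: sum.distrib)
qed simp

lemma colored_mset_perms_letters:
  assumes "w \<in> colored_mset_perms n m rr" "\<forall>k\<in>{1..n}. rr k = r"
  shows "set w \<subseteq> {1..n} \<times> {1..r}"
proof -
  \<comment> \<open>The multiplicities of the keys in \<open>{1..n}\<close> already add up to the
    length, leaving no position for another key.\<close>
  have "length (filter (\<lambda>x. x \<in> {1..n}) (map fst w)) = length (map fst w)"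
    using assms(1) unfolding colored_mset_perms_def
    by (subst sum_count_list_eq_length_filter[symmetric]) auto
  then have "\<forall>x\<in>set (map fst w). x \<in> {1..n}"
    by (metis length_filter_less less_irrefl)
  then show ?thesis using assms by (fastforce simp: colored_mset_perms_def)
qed

lemma finite_colored_mset_perms:
  assumes "\<forall>k\<in>{1..n}. rr k = r"
  shows "finite (colored_mset_perms n m rr)"
proof (rule finite_subset)
  show "colored_mset_perms n m rr \<subseteq>
    {w. set w \<subseteq> {1..n} \<times> {1..r} \<and> length w = (\<Sum>k=1..n. m k)}"
    using colored_mset_perms_letters[OF _ assms] by (auto simp: colored_mset_perms_def)
qed (simp add: finite_lists_length_eq)

definition letter_rank :: "nat \<Rightarrow> nat \<times> nat \<Rightarrow> nat" where
  "letter_rank n a = (snd a - 1) * n + (fst a - 1)"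

text \<open>Inverse of \<open>letter_rank n\<close> on ranks. Reducing the color modulo
  \<open>r\<close> extends it to lifted ranks, where it forgets the barriers.\<close>

definition nth_letter :: "nat \<Rightarrow> nat \<Rightarrow> nat \<Rightarrow> nat \<times> nat" where
  "nth_letter n r x = (Suc (x mod n), Suc (x div n mod r))"

lemma letter_rank_nth_letter: "letter_rank n (nth_letter n r x) = x mod (n * r)"
  by (simp add: letter_rank_def nth_letter_def mod_mult2_eq mult.commute)

lemma mult_add_less_mult_add_iff:
  fixes n :: nat
  assumes "a < n" "b < n"
  shows "d * n + a < e * n + b \<longleftrightarrow> d < e \<or> d = e \<and> a < b"
proof -
  have "d * n + a < e * n + b" if "d < e" "a < n" for d e a b
  proof -
    have "Suc d * n \<le> e * n" using that by (intro mult_le_mono1) simp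
    then show ?thesis using that by simp
  qed
  then show ?thesis using assms
    by (metis add_less_cancel_left linorder_neqE_nat less_asym)
qed

lemma letter_rank_less:
  assumes "a \<in> {1..n} \<times> {1..r}"
  shows "letter_rank n a < n * r"
proof -
  have "letter_rank n a < r * n + 0"
    unfolding letter_rank_def using assms
    by (subst mult_add_less_mult_add_iff) auto
  then show ?thesis by (simp add: mult.commute)
qed

lemma nth_letter_letter_rank:
  assumes "a \<in> {1..n} \<times> {1..r}"
  shows "nth_letter n r (letter_rank n a) = a"
proof -
  from assms have "fst a \<ge> 1" "snd a \<ge> 1" by auto
  then obtain k c where "a = (Suc k, Suc c)"
    by (metis One_nat_def Suc_le_D prod.collapse)
  then show ?thesis using assms by (auto simp: nth_letter_def letter_rank_def)
qed

lemma colored_less_iff_letter_rank: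
  assumes "a \<in> {1..n} \<times> {1..r}" "b \<in> {1..n} \<times> {1..r}"
  shows "colored_less a b \<longleftrightarrow> letter_rank n a < letter_rank n b"
proof -
  have "letter_rank n a < letter_rank n b \<longleftrightarrow>
      snd a - 1 < snd b - 1 \<or> snd a - 1 = snd b - 1 \<and> fst a - 1 < fst b - 1"
    unfolding letter_rank_def using assms by (intro mult_add_less_mult_add_iff) auto
  then show ?thesis using assms by (auto simp: colored_less_def)
qed

text \<open>The appended letter \<open>(n+1)\<^sup>1\<close> has no rank of its own; it comes right after the \<open>n\<close> letters
  of color 1, the last of which has rank \<open>n - 1\<close>.\<close>

lemma colored_less_last_iff_letter_rank:
  assumes "a \<in> {1..n} \<times> {1..r}"
  shows "colored_less (n + 1, 1) a \<longleftrightarrow> n - 1 < letter_rank n a"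
proof -
  have "0 * n + (n - 1) < letter_rank n a \<longleftrightarrow> 0 < snd a - 1 \<or> 0 = snd a - 1 \<and> n - 1 < fst a - 1"
    unfolding letter_rank_def using assms by (intro mult_add_less_mult_add_iff) auto
  then show ?thesis using assms by (auto simp: colored_less_def)
qed

lemma des_eq_rank_des:
  assumes "set w \<subseteq> {1..n} \<times> {1..r}"
  shows "des n w = rank_des (map (letter_rank n) w) (n - 1)"
proof -
  have "colored_less ((w @ [(n + 1, 1)]) ! (j + 1)) ((w @ [(n + 1, 1)]) ! j) \<longleftrightarrow>
      (map (letter_rank n) w @ [n - 1]) ! Suc j < (map (letter_rank n) w @ [n - 1]) ! j"
    if j: "j < length w" for j
  proof -
    have wj: "w ! j \<in> {1..n} \<times> {1..r}" using assms j nth_mem by blast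
    show ?thesis
    proof (cases "Suc j < length w")
      case True
      then have "w ! Suc j \<in> {1..n} \<times> {1..r}" using assms nth_mem by blast
      then show ?thesis using True j wj colored_less_iff_letter_rank by (simp add: nth_append)
    next
      \<comment> \<open>At the last position the appended letter is represented by the rank
        \<open>n - 1\<close>. The letter \<open>(n, 1)\<close> has the same rank but is smaller than
        \<open>(n + 1, 1)\<close>, so the tie is rightly no descent.\<close>
      case False
      then have "length w = Suc j" using j by simp
      then show ?thesis using wj colored_less_last_iff_letter_rank by (simp add: nth_append)
    qed
  qed
  then show ?thesis unfolding des_def rank_des_def by (metis (mono_tags, lifting) length_map)
qed

text \<open>\<open>nth_letter\<close> depends only on the residue modulo \<open>n * r\<close>. Hence
  a list determines its word, which makes the lifts of different words disjoint.\<close>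

lemma map_nth_letter_sorted_lifts:
  assumes "set w \<subseteq> {1..n} \<times> {1..r}" "xs \<in> sorted_lifts (n * r) (map (letter_rank n) w) b"
  shows "map (nth_letter n r) xs = w"
proof -
  have mod: "nth_letter n r (x mod (n * r)) = nth_letter n r x" for x
    by (cases "n = 0") (simp_all add: nth_letter_def mod_mult2_eq)
  have "map (nth_letter n r) xs = map (nth_letter n r) (map (\<lambda>x. x mod (n * r)) xs)"
    by (simp add: mod)
  also have "\<dots> = map (nth_letter n r) (map (letter_rank n) w)"
    using assms by (simp add: sorted_lifts_def)
  also have "\<dots> = w"
    unfolding map_map using assms(1) nth_letter_letter_rank
    by (intro map_idI) (metis comp_apply subsetD)
  finally show ?thesis .
qed

text \<open>The sorted list \<open>x\<^sub>1 \<le> \<dots> \<le> x\<^sub>m\<close> encodes a word together with barriers: the letter at position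
  \<open>j\<close> is the \<open>x\<^sub>j mod nr\<close>-th letter in the colored order, and the quotients \<open>x\<^sub>j div nr\<close>
  are weakly increasing and increase strictly at descents. The quotient \<open>x\<^sub>j div n\<close> combines
  color and barrier, so that the lists are counted by multisets for each \<open>k\<close> separately.\<close>

lemma sorted_with_residues_eq_UN_sorted_lifts:
  assumes "n > 0" "r > 0" and rr: "\<forall>k\<in>{1..n}. rr k = r"
  shows "sorted_with_residues n (\<lambda>k. m (Suc k)) (r * t) =
    (\<Union>w\<in>colored_mset_perms n m rr. sorted_lifts (n * r) (map (letter_rank n) w) (t * (n * r) + (n - 1)))"
proof -
  have count: "count_list (map fst (map (nth_letter n r) xs)) (Suc k) = length (filter (\<lambda>x. x mod n = k) xs)"
    for xs k
    by (induction xs) (auto simp: nth_letter_def)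
  \<comment> \<open>The appended rank \<open>n - 1\<close> lets the range end with a full block of
    \<open>n\<close> numbers, so each residue class modulo \<open>n\<close> has
    \<open>r * t + 1\<close> members.\<close>
  have bound: "x \<le> t * (n * r) + (n - Suc 0) \<longleftrightarrow> x < n + n * (r * t)" for x
    using assms(1) by (auto simp: mult_ac)
  show ?thesis
  proof (intro equalityI subsetI)
    fix xs assume xs: "xs \<in> sorted_with_residues n (\<lambda>k. m (Suc k)) (r * t)"
    let ?w = "map (nth_letter n r) xs"
    have counts: "count_list (map fst ?w) k = m k" if "k \<in> {1..n}" for k
      using xs that count[of xs "k - 1"] by (auto simp: sorted_with_residues_def)
    have "set (map fst ?w) \<subseteq> {1..n}"
      using assms(1) by (auto simp: nth_letter_def Suc_le_eq)
    then have "length (map fst ?w) = (\<Sum>k=1..n. count_list (map fst ?w) k)"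
      by (intro sum_count_set[symmetric]) auto
    also have "\<dots> = (\<Sum>k=1..n. m k)" using counts by (intro sum.cong) auto
    finally have "?w \<in> colored_mset_perms n m rr"
      using counts assms by (auto simp: colored_mset_perms_def nth_letter_def Suc_le_eq)
    moreover have "xs \<in> sorted_lifts (n * r) (map (letter_rank n) ?w) (t * (n * r) + (n - 1))"
      using xs by (auto simp: sorted_lifts_def sorted_with_residues_def letter_rank_nth_letter bound)
    ultimately show "xs \<in> (\<Union>w\<in>colored_mset_perms n m rr.
        sorted_lifts (n * r) (map (letter_rank n) w) (t * (n * r) + (n - 1)))" by blast
  next
    fix xs assume "xs \<in> (\<Union>w\<in>colored_mset_perms n m rr.
        sorted_lifts (n * r) (map (letter_rank n) w) (t * (n * r) + (n - 1)))"
    then obtain w where w: "w \<in> colored_mset_perms n m rr"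
      and xs: "xs \<in> sorted_lifts (n * r) (map (letter_rank n) w) (t * (n * r) + (n - 1))" by blast
    have "map (nth_letter n r) xs = w"
      using map_nth_letter_sorted_lifts[OF colored_mset_perms_letters[OF w rr] xs] .
    then have "length (filter (\<lambda>x. x mod n = k) xs) = m (Suc k)" if "k < n" for k
      using w that count[of xs k] by (auto simp: colored_mset_perms_def)
    then show "xs \<in> sorted_with_residues n (\<lambda>k. m (Suc k)) (r * t)"
      using xs by (auto simp: sorted_with_residues_def sorted_lifts_def bound)
  qed
qed

text \<open>Double counting of the sorted lists with entries below \<open>n * Suc (r * t)\<close>:
  by the word they encode on the left, by residues modulo \<open>n\<close> on the right.\<close>

lemma sum_choose_des_colored_mset_perms:
  assumes "n > 0" "r > 0" and rr: "\<forall>k\<in>{1..n}. rr k = r"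
  shows "(\<Sum>w\<in>colored_mset_perms n m rr. (t + length w - des n w) choose length w) =
    (\<Prod>k=1..n. (r * t + m k) choose m k)"
proof -
  let ?P = "colored_mset_perms n m rr"
  let ?L = "\<lambda>w. sorted_lifts (n * r) (map (letter_rank n) w) (t * (n * r) + (n - 1))"
  note letters = colored_mset_perms_letters[OF _ rr]
  have "(\<Sum>w\<in>?P. (t + length w - des n w) choose length w) = (\<Sum>w\<in>?P. card (?L w))"
  proof (intro sum.cong refl)
    fix w assume w: "w \<in> ?P"
    have "n * 1 \<le> n * r" using assms by (intro mult_le_mono2) simp
    then have "n - 1 < n * r" using assms by linarith
    then show "(t + length w - des n w) choose length w = card (?L w)"
      using letters[OF w] letter_rank_less
      by (subst card_sorted_lifts) (auto simp: des_eq_rank_des[OF letters[OF w]] subset_iff)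
  qed
  also have "\<dots> = card (\<Union>w\<in>?P. ?L w)"
  proof (rule card_UN_disjoint[symmetric])
    show "\<forall>v\<in>?P. \<forall>w\<in>?P. v \<noteq> w \<longrightarrow> ?L v \<inter> ?L w = {}"
      using map_nth_letter_sorted_lifts[OF letters] by blast
  qed (auto simp: finite_colored_mset_perms[OF rr] finite_sorted_lifts)
  also have "\<dots> = (\<Prod>k<n. (r * t + m (Suc k)) choose m (Suc k))"
    unfolding sorted_with_residues_eq_UN_sorted_lifts[OF assms, symmetric]
    using assms(1) by (rule card_sorted_with_residues)
  also have "\<dots> = (\<Prod>k=1..n. (r * t + m k) choose m k)"
    by (rule prod.reindex_bij_witness[where i = "\<lambda>k. k - 1" and j = Suc]) auto
  finally show ?thesis .
qed

text \<open>Each word's monomial is its series of barrier counts times the power of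
  \<open>1 - fps_X\<close>. That power is common to all words, so the counts can be added
  coefficientwise.\<close>

lemma fps_of_poly_colored_mset_eulerian:
  assumes "n > 0" "r > 0" and rr: "\<forall>k\<in>{1..n}. rr k = r"
  shows "fps_of_poly (colored_mset_eulerian n m rr) =
    Abs_fps (\<lambda>t. int (\<Prod>k=1..n. (r * t + m k) choose m k)) * (1 - fps_X) ^ Suc (\<Sum>k=1..n. m k)"
proof -
  let ?P = "colored_mset_perms n m rr" and ?m = "\<Sum>k=1..n. m k"
  have len: "length w = ?m" if "w \<in> ?P" for w
    using that by (auto simp: colored_mset_perms_def)
  have count: "(\<Sum>w\<in>?P. (t + ?m - des n w) choose ?m) = (\<Prod>k=1..n. (r * t + m k) choose m k)" for t
    unfolding sum_choose_des_colored_mset_perms[OF assms, symmetric]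
    by (intro sum.cong) (simp_all add: len)
  have "des n w \<le> ?m" if "w \<in> ?P" for w
    using rank_des_le_length[of "map (letter_rank n) w" "n - 1"] len[OF that]
    by (simp add: des_eq_rank_des[OF colored_mset_perms_letters[OF that rr]])
  then have "fps_of_poly (colored_mset_eulerian n m rr) =
      (\<Sum>w\<in>?P. Abs_fps (\<lambda>t. int ((t + ?m - des n w) choose ?m)) * (1 - fps_X) ^ Suc ?m)"
    unfolding colored_mset_eulerian_def fps_of_poly_sum fps_of_poly_monom'
    by (intro sum.cong refl fps_shifted_choose_power[symmetric])
  also have "\<dots> = (\<Sum>w\<in>?P. Abs_fps (\<lambda>t. int ((t + ?m - des n w) choose ?m))) * (1 - fps_X) ^ Suc ?m"
    by (rule sum_distrib_right[symmetric])
  also have "(\<Sum>w\<in>?P. Abs_fps (\<lambda>t. int ((t + ?m - des n w) choose ?m))) =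
      Abs_fps (\<lambda>t. int (\<Prod>k=1..n. (r * t + m k) choose m k))"
    by (rule fps_ext) (simp only: fps_sum_nth fps_nth_Abs_fps count flip: of_nat_sum)
  finally show ?thesis .
qed

section \<open>Sequences for the three vectors\<close>

theorem proposition23:
  fixes n r :: nat and m rr :: "nat \<Rightarrow> nat"
  assumes "n \<ge> 1" and "r \<ge> 1"
    and "(\<forall>k\<in>{1..n}. m k = 1) \<or>
         (\<forall>k\<in>{1..n}. m k = 2) \<or>
         ((\<forall>k\<in>{1..<n}. m k = 2) \<and> m n = 1)"
    and "\<forall>k\<in>{1..n}. rr k = r"
  shows "is_s_eulerian (colored_mset_eulerian n m rr)"
proof -
  have nr: "n > 0" "r > 0" using assms by auto
  note series = fps_of_poly_colored_mset_eulerian[OF nr assms(4), of m]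
  \<comment> \<open>Scaling \<open>s\<close> by \<open>r\<close> replaces \<open>q\<close> by
    \<open>r * t\<close> in the count, so each case only has to supply the count for the unscaled
    sequence.\<close>
  have eulerianI: "is_s_eulerian (colored_mset_eulerian n m rr)"
    if s: "\<forall>i\<ge>1. s i > 0" and N: "N = (\<Sum>k=1..n. m k)" "N > 0"
      and card: "\<And>q. card (lecture_hall_functions s N (q * s N)) = (\<Prod>k=1..n. (q + m k) choose m k)"
    for s N
  proof -
    have "s_eulerian_poly (\<lambda>i. r * s i) N = colored_mset_eulerian n m rr"
      using s nr(2) N(2)
    proof (rule s_eulerian_poly_eqI)
      show "card (lecture_hall_functions s N 0) = 1" using card[of 0] by simp
    qed (use series card[of "r * _"] in \<open>simp add: N(1)\<close>)
    then show ?thesis unfolding is_s_eulerian_def using s nr N(2)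
      by (intro exI[of _ "\<lambda>i. r * s i"] exI[of _ N]) auto
  qed
  consider (ones) "\<forall>k\<in>{1..n}. m k = 1" | (twos) "\<forall>k\<in>{1..n}. m k = 2"
    | (mixed) "\<forall>k\<in>{1..<n}. m k = 2" "m n = 1"
    using assms(3) by blast
  then show ?thesis
  proof cases
    case ones
    show ?thesis
    proof (rule eulerianI[where s = "\<lambda>i. i" and N = n])
      show "card (lecture_hall_functions (\<lambda>i. i) n (q * n)) = (\<Prod>k=1..n. (q + m k) choose m k)" for q
        using card_lecture_hall_functions_id[of 0 n q] ones by simp
    qed (use ones nr in auto)
  next
    case twos
    show ?thesis
    proof (rule eulerianI[OF pair_seq_pos, where N = "2 * n"])
      show "card (lecture_hall_functions pair_seq (2 * n) (q * pair_seq (2 * n))) =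
          (\<Prod>k=1..n. (q + m k) choose m k)" for q
        using card_lecture_hall_functions_pair_seq_even[where p = 0 and i = n and q = q] twos by (simp add: pair_seq_def)
    qed (use twos nr in auto)
  next
    case mixed
    \<comment> \<open>The \<open>i\<close> entries 2 account for the first \<open>2 * i\<close>
      coordinates; the final entry 1 is the extra odd coordinate, with factor
      \<open>q + 1\<close>.\<close>
    obtain i where i: "n = Suc i" using nr by (cases n) auto
    have m: "m k = 2" if "k \<in> {1..i}" for k using mixed(1) that i by auto
    show ?thesis
    proof (rule eulerianI[OF pair_seq_pos, where N = "Suc (2 * i)"])
      show "card (lecture_hall_functions pair_seq (Suc (2 * i)) (q * pair_seq (Suc (2 * i)))) =
          (\<Prod>k=1..n. (q + m k) choose m k)" for q
        using card_lecture_hall_functions_pair_seq_odd[where p = 0 and i = i and q = q] m mixed(2) i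
        by (simp add: pair_seq_def)
      show "Suc (2 * i) = (\<Sum>k=1..n. m k)" using m mixed(2) i by simp
    qed simp
  qed
qed

end
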